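(* Let $\mathbf{d}, K \in \mathbb{N}$, $L, \alpha \in \mathbb{R}$, $\beta \in (\alpha,\infty)$, let $(\Omega,\mathcal{F},\mathbb{P})$ be a probability space, let $\mathcal{R} \colon [\alpha,\beta]^{\mathbf{d}} \times \Omega \to \mathbb{R}$ be a random field, assume for all $\theta,\vartheta \in [\alpha,\beta]^{\mathbf{d}}$, $\omega \in \Omega$ that $|\mathcal{R}(\theta,\omega) - \mathcal{R}(\vartheta,\omega)| \leq L\|\theta-\vartheta\|_\infty$, let $\Theta_k \colon \Omega \to [\alpha,\beta]^{\mathbf{d}}$, $k \in \{1,2,\ldots,K\}$, be i.i.d. random variables, and assume that $\Theta_1$ is continuous uniformly distributed on $[\alpha,\beta]^{\mathbf{d}}$. Then (i) $\mathcal{R}$ is a $(\mathcal{B}([\alpha,\beta]^{\mathbf{d}}) \otimes \mathcal{F})$/$\mathcal{B}(\mathbb{R})$-measurable function, and (ii) it holds for all $\theta \in [\alpha,\beta]^{\mathbf{d}}$, $p \in (0,\infty)$ that $$\Bigl(\mathbb{E}\Bigl[\min_{k \in \{1,2,\ldots,K\}} |\mathcal{R}(\Theta_k) - \mathcal{R}(\theta)|^p\Bigr]\Bigr)^{1/p} \leq \frac{L(\beta-\alpha)\max\{1,(p/\mathbf{d})^{1/\mathbf{d}}\}}{K^{1/\mathbf{d}}} \leq \frac{L(\beta-\alpha)\max\{1,p\}}{K^{1/\mathbf{d}}}.$$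
   Context: $\mathbb{N} = \{1,2,\ldots\}$; $\|\theta\|_\infty = \max_i |\theta_i|$; $\mathcal{B}(\cdot)$ denotes the Borel $\sigma$-algebra. That $\mathcal{R}$ is a random field means that for every $\theta$ the function $\omega \mapsto \mathcal{R}(\theta,\omega)$ is $\mathcal{F}$/$\mathcal{B}(\mathbb{R})$-measurable. $\mathcal{R}(\Theta_k)$ denotes $\omega \mapsto \mathcal{R}(\Theta_k(\omega),\omega)$ and $\mathcal{R}(\theta)$ denotes $\omega \mapsto \mathcal{R}(\theta,\omega)$. *)

theory Defs
  imports "HOL-Probability.Probability"
begin

abbreviation cube :: "real \<Rightarrow> real \<Rightarrow> (real ^ 'd) set"
  where "cube \<alpha> \<beta> \<equiv> cbox (vec \<alpha>) (vec \<beta>)"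

abbreviation cube_borel :: "real \<Rightarrow> real \<Rightarrow> (real ^ 'd) measure"
  where "cube_borel \<alpha> \<beta> \<equiv> restrict_space borel (cube \<alpha> \<beta>)"

text \<open>
  Only the values of \<open>R \<theta> \<omega>\<close> with \<open>\<theta> \<in> cube \<alpha> \<beta>\<close> and \<open>\<omega> \<in> space M\<close> are constrained.
\<close>
definition random_field_on_cube ::
    "'w measure \<Rightarrow> real \<Rightarrow> real \<Rightarrow> (real ^ 'd \<Rightarrow> 'w \<Rightarrow> real) \<Rightarrow> bool"
  where "random_field_on_cube M \<alpha> \<beta> R \<longleftrightarrow> (\<forall>\<theta>\<in>cube \<alpha> \<beta>. R \<theta> \<in> borel_measurable M)"

text \<open>
  All \<open>X i\<close> are compared with each other, so no index is singled out. That each \<open>X i\<close> with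
  \<open>i \<in> I\<close> is a measurable map from \<open>M\<close> to \<open>N\<close> is part of \<^const>\<open>prob_space.indep_vars\<close>.
\<close>
definition iid_vars :: "'w measure \<Rightarrow> 'b measure \<Rightarrow> ('i \<Rightarrow> 'w \<Rightarrow> 'b) \<Rightarrow> 'i set \<Rightarrow> bool"
  where "iid_vars M N X I \<longleftrightarrow>
    prob_space.indep_vars M (\<lambda>_. N) X I \<and>
    (\<forall>i\<in>I. \<forall>j\<in>I. distr M N (X i) = distr M N (X j))"

end

theory Submission
  imports Defs
begin

text \<open>
  Let \<open>U\<close> be the smallest distance of the sample points to \<open>\<theta>\<close>. Independence gives
  \<open>P(U > t (\<beta> - \<alpha>)) \<le> (1 - t^d)^K \<le> exp (- K t^d)\<close>, so \<open>V = K (U / (\<beta> - \<alpha>))^d\<close> is stochastically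
  dominated by a standard exponential variable. Hence \<open>E[V^a] \<le> \<Gamma>(a + 1) \<le> max 1 (a^a)\<close> for
  \<open>a = p / d\<close>, and the minimum in the statement is at most
  \<open>(L U)^p = (L (\<beta> - \<alpha>))^p K^{-a} V^a\<close>.
\<close>

section \<open>Bounds for the Gamma function\<close>

text \<open>\<open>Gamma\<close> is log-convex and equals 1 at 1 and at 2, so between these points
  its logarithm lies below the chord, which is 0.\<close>

lemma Gamma_add_one_le_one:
  fixes a :: real
  assumes "0 < a" "a \<le> 1"
  shows "Gamma (a + 1) \<le> 1"
proof -
  have "(ln \<circ> Gamma) ((1 - a) *\<^sub>R 1 + a *\<^sub>R 2) \<le> (1 - a) * (ln \<circ> Gamma) 1 + a * (ln \<circ> Gamma) (2::real)"
    by (rule convex_onD[OF log_convex_Gamma_real]) (use assms in auto)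
  moreover have "Gamma (2::real) = 1"
    using Gamma_fact[of 1, where 'a = real] by simp
  ultimately have "ln (Gamma (a + 1)) \<le> 0"
    by (simp add: algebra_simps)
  thus ?thesis
    using Gamma_real_pos[of "a + 1"] assms by simp
qed

text \<open>The functional equation lowers the argument by one until it falls into the range of the
  previous bound. The form \<open>a powr a\<close> suits the final root: for
  \<open>a = p / d\<close> its \<open>p\<close>-th root is
  \<open>(p / d) powr (1 / d)\<close>.\<close>

lemma Gamma_add_one_le:
  fixes a :: real
  assumes "0 < a"
  shows "Gamma (a + 1) \<le> max 1 (a powr a)"
proof -
  \<comment> \<open>The number \<open>n\<close> is an upper bound for the real argument
    \<open>a\<close>, introduced to have something to induct on.\<close>
  have "Gamma (a + 1) \<le> max 1 (a powr a)" if "0 < a" "a \<le> real (Suc n)" for n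
    using that
  proof (induction n arbitrary: a)
    case 0
    thus ?case using Gamma_add_one_le_one[of a] by simp
  next
    case (Suc n)
    show ?case
    proof (cases "a \<le> 1")
      case True
      thus ?thesis using Gamma_add_one_le_one[of a] Suc.prems by simp
    next
      case False
      have "Gamma (a + 1) = a * Gamma (a - 1 + 1)"
        using Gamma_plus1[of a] Suc.prems by (auto simp: nonpos_Ints_def)
      also have "\<dots> \<le> a * max 1 ((a - 1) powr (a - 1))"
        using Suc.IH[of "a - 1"] Suc.prems False by (intro mult_left_mono) auto
      \<comment> \<open>Both 1 and \<open>(a - 1) powr (a - 1)\<close> are at most
        \<open>a powr (a - 1)\<close>, since \<open>a\<close> exceeds 1 here.\<close>
      also have "\<dots> \<le> a * a powr (a - 1)"
        using False by (intro mult_left_mono max.boundedI ge_one_powr_ge_zero powr_mono2) auto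
      also have "\<dots> = a powr a"
        using False by (simp add: powr_mult_base)
      finally show ?thesis by simp
    qed
  qed
  moreover obtain n where "a \<le> real n"
    using real_arch_simple by blast
  ultimately show ?thesis
    using assms by (metis of_nat_le_iff order_trans le_SucI order_refl)
qed

section \<open>Moments under an exponential tail\<close>

text \<open>Layer-cake formula: \<open>V powr a\<close> is the integral of
  \<open>a * v powr (a - 1)\<close> over 0 < v < V. Exchanging the integrals leaves this weight
  against the tail probability, and the bound \<open>exp (- v)\<close> turns the result into Euler's
  integral for \<open>a * Gamma a\<close>.\<close>

lemma nn_integral_powr_le_Gamma:
  fixes V :: "'w \<Rightarrow> real"
  assumes "prob_space M" and [measurable]: "V \<in> borel_measurable M"
    and nonneg: "\<And>x. x \<in> space M \<Longrightarrow> 0 \<le> V x"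
    and tail: "\<And>v. 0 \<le> v \<Longrightarrow> emeasure M {x\<in>space M. v < V x} \<le> ennreal (exp (- v))"
    and a: "0 < a"
  shows "(\<integral>\<^sup>+x. ennreal (V x powr a) \<partial>M) \<le> ennreal (Gamma (a + 1))"
proof -
  interpret prob_space M by fact
  interpret pair_sigma_finite M lborel ..
  define h where "h v = ennreal (a * v powr (a - 1)) * indicator {0<..} v" for v :: real
  have [measurable]: "h \<in> borel_measurable borel"
    unfolding h_def by measurable
  have "(\<integral>\<^sup>+x. ennreal (V x powr a) \<partial>M)
      = (\<integral>\<^sup>+x. (\<integral>\<^sup>+v. h v * indicator {..<V x} v \<partial>lborel) \<partial>M)"
  proof (rule nn_integral_cong)
    fix x assume x: "x \<in> space M"
    have "((\<lambda>v. v powr (a - 1)) has_integral V x powr a / a) {0..V x}"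
      using has_integral_powr_from_0[of "a - 1" "V x"] a nonneg[OF x] by simp
    hence "((\<lambda>v. a * v powr (a - 1)) has_integral V x powr a) {0..V x}"
      by (rule has_integral_mult_right[THEN has_integral_eq_rhs]) (use a in simp)
    hence "(\<integral>\<^sup>+v. ennreal (indicator {0..V x} v * (a * v powr (a - 1))) \<partial>lborel) = ennreal (V x powr a)"
      by (intro nn_integral_has_integral_lebesgue) (use a in auto)
    moreover have "(\<integral>\<^sup>+v. ennreal (indicator {0..V x} v * (a * v powr (a - 1))) \<partial>lborel)
        = (\<integral>\<^sup>+v. h v * indicator {..<V x} v \<partial>lborel)"
    proof (rule nn_integral_cong_AE)
      \<comment> \<open>The two integrands can differ only at the end points 0 and
        \<open>V x\<close>, which form a null set.\<close>
      have "AE v in lborel. v \<noteq> 0 \<and> v \<noteq> V x"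
        using AE_lborel_singleton[of "0::real"] AE_lborel_singleton[of "V x"] by eventually_elim auto
      thus "AE v in lborel. ennreal (indicator {0..V x} v * (a * v powr (a - 1))) = h v * indicator {..<V x} v"
        by eventually_elim (auto simp: h_def indicator_def)
    qed
    ultimately show "ennreal (V x powr a) = (\<integral>\<^sup>+v. h v * indicator {..<V x} v \<partial>lborel)"
      by simp
  qed
  also have "\<dots> = (\<integral>\<^sup>+x. (\<integral>\<^sup>+v. (if v < V x then h v else 0) \<partial>lborel) \<partial>M)"
    by (intro nn_integral_cong) (auto simp: indicator_def)
  also have "\<dots> = (\<integral>\<^sup>+v. (\<integral>\<^sup>+x. (if v < V x then h v else 0) \<partial>M) \<partial>lborel)"
    by (rule Fubini'[symmetric]) measurable
  also have "\<dots> = (\<integral>\<^sup>+v. (\<integral>\<^sup>+x. h v * indicator {x\<in>space M. v < V x} x \<partial>M) \<partial>lborel)"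
    by (intro nn_integral_cong) (auto simp: indicator_def)
  also have "\<dots> = (\<integral>\<^sup>+v. h v * emeasure M {x\<in>space M. v < V x} \<partial>lborel)"
    by (intro nn_integral_cong) (subst nn_integral_cmult_indicator, auto)
  also have "\<dots> \<le> (\<integral>\<^sup>+v. ennreal (indicator {0..} v * (a * (v powr (a - 1) / exp v))) \<partial>lborel)"
  proof (rule nn_integral_mono)
    fix v :: real
    show "h v * emeasure M {x\<in>space M. v < V x} \<le> ennreal (indicator {0..} v * (a * (v powr (a - 1) / exp v)))"
    proof (cases "0 < v")
      case True
      have "h v * emeasure M {x\<in>space M. v < V x} \<le> ennreal (a * v powr (a - 1)) * ennreal (exp (- v))"
        using True tail[of v] by (simp add: h_def mult_left_mono)
      also have "\<dots> = ennreal (indicator {0..} v * (a * (v powr (a - 1) / exp v)))"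
        using True a by (simp add: ennreal_mult[symmetric] exp_minus field_simps)
      finally show ?thesis .
    qed (simp add: h_def)
  qed
  also have "\<dots> = ennreal (a * Gamma a)"
    by (intro nn_integral_has_integral_lebesgue has_integral_mult_right Gamma_integral_real) (use a in auto)
  also have "a * Gamma a = Gamma (a + 1)"
    using Gamma_plus1[of a] a by (auto simp: nonpos_Ints_def)
  finally show ?thesis .
qed

section \<open>Joint measurability of a Lipschitz random field\<close>

text \<open>
  A Lipschitz function is the infimal convolution of its restriction to a countable dense set
  with the cone \<open>C * dist\<close>; this turns the field into a countable infimum.
\<close>
lemma borel_measurable_lipschitz_random_field:
  fixes R :: "'a::{metric_space, second_countable_topology} \<Rightarrow> 'w \<Rightarrow> real"
  assumes R: "\<And>\<theta>. \<theta> \<in> S \<Longrightarrow> R \<theta> \<in> borel_measurable M"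
    and lip: "\<And>\<theta> \<phi> \<omega>. \<theta> \<in> S \<Longrightarrow> \<phi> \<in> S \<Longrightarrow> \<omega> \<in> space M \<Longrightarrow> \<bar>R \<theta> \<omega> - R \<phi> \<omega>\<bar> \<le> C * dist \<theta> \<phi>"
    and C: "0 \<le> C"
  shows "(\<lambda>(\<theta>, \<omega>). R \<theta> \<omega>) \<in> borel_measurable (restrict_space borel S \<Otimes>\<^sub>M M)"
proof -
  obtain T where T: "countable T" "T \<subseteq> S" "S \<subseteq> closure T"
    using separable .
  \<comment> \<open>Under the infimum the variables are separated: \<open>R q\<close> depends on the
    outcome alone and the cone on the point alone.\<close>
  have "(\<lambda>z. INF q\<in>T. R q (snd z) + C * dist (fst z) q) \<in> borel_measurable (restrict_space borel S \<Otimes>\<^sub>M M)"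
  proof (rule borel_measurable_cINF_real[OF T(1)])
    fix q assume "q \<in> T"
    hence [measurable]: "R q \<in> borel_measurable M" using T R by auto
    have [measurable]: "(\<lambda>z. fst z) \<in> restrict_space borel S \<Otimes>\<^sub>M M \<rightarrow>\<^sub>M borel"
      by (rule measurable_compose[OF measurable_fst]) (rule measurable_restrict_space1, simp)
    show "(\<lambda>z. R q (snd z) + C * dist (fst z) q) \<in> borel_measurable (restrict_space borel S \<Otimes>\<^sub>M M)"
      by measurable
  qed
  moreover have "(INF q\<in>T. R q \<omega> + C * dist \<theta> q) = R \<theta> \<omega>"
    if "\<theta> \<in> S" "\<omega> \<in> space M" for \<theta> \<omega>
  proof (rule cInf_eq)
    fix y assume "y \<in> (\<lambda>q. R q \<omega> + C * dist \<theta> q) ` T"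
    then obtain q where q: "q \<in> T" "y = R q \<omega> + C * dist \<theta> q" by auto
    thus "R \<theta> \<omega> \<le> y" using lip[of \<theta> q \<omega>] that T by auto
  next
    fix y assume y: "\<And>x. x \<in> (\<lambda>q. R q \<omega> + C * dist \<theta> q) ` T \<Longrightarrow> y \<le> x"
    show "y \<le> R \<theta> \<omega>"
    proof (rule field_le_epsilon)
      fix e :: real assume e: "0 < e"
      have "\<theta> \<in> closure T" using that T by auto
      \<comment> \<open>Moving from \<theta> to \<open>q\<close> costs \<open>C * dist\<close>
        twice, once in the Lipschitz bound and once in the cone. The denominator
        \<open>2 * C + 1\<close> stays positive when \<open>C\<close> is 0.\<close>
      then obtain q where q: "q \<in> T" "dist q \<theta> < e / (2 * C + 1)"
        unfolding closure_approachable using e C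
        by (meson add_nonneg_pos divide_pos_pos mult_nonneg_nonneg zero_le_numeral zero_less_one)
      have "y \<le> R q \<omega> + C * dist \<theta> q" using y q by auto
      also have "\<dots> \<le> R \<theta> \<omega> + (2 * C) * dist q \<theta>"
        using lip[of \<theta> q \<omega>] that q T by (auto simp: dist_commute)
      also have "(2 * C) * dist q \<theta> \<le> (2 * C + 1) * dist q \<theta>"
        by (intro mult_right_mono) auto
      also have "\<dots> \<le> e"
        using q C by (simp add: field_simps)
      finally show "y \<le> R \<theta> \<omega> + e" by simp
    qed
  qed
  ultimately show ?thesis
    by (subst (asm) measurable_cong[where g = "\<lambda>(\<theta>, \<omega>). R \<theta> \<omega>"])
       (auto simp: space_pair_measure space_restrict_space)
qed

section \<open>Volumes of sup-norm balls inside the cube\<close>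

text \<open>
  The worst case is a corner of the cube: in every coordinate the interval of radius
  \<open>\<epsilon>\<close> around \<open>\<theta>\<close> meets \<open>[\<alpha>, \<beta>]\<close> in length at least \<open>\<epsilon>\<close>.
\<close>
lemma content_infnorm_ball_Int_cube_ge:
  fixes \<theta> :: "real ^ 'd"
  assumes \<theta>: "\<theta> \<in> cube \<alpha> \<beta>" and \<epsilon>: "0 \<le> \<epsilon>" "\<epsilon> \<le> \<beta> - \<alpha>"
  shows "\<epsilon> ^ CARD('d) \<le> measure lborel (cube \<alpha> \<beta> \<inter> {x. infnorm (x - \<theta>) \<le> \<epsilon>})"
proof -
  \<comment> \<open>In each coordinate the interval of length \<epsilon> starting at
    \<open>a $ i\<close> either ends at \<open>\<theta> $ i\<close> or starts at \<alpha>. In both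
    cases it contains \<open>\<theta> $ i\<close> and stays within the bounds of the cube, so the
    box lies in the ball and in the cube.\<close>
  define a :: "real ^ 'd" where "a = (\<chi> i. max \<alpha> (\<theta> $ i - \<epsilon>))"
  have closed: "closed {x. infnorm (x - \<theta>) \<le> \<epsilon>}"
    by (intro closed_Collect_le continuous_intros)
  have "cbox a (a + vec \<epsilon>) \<noteq> {}"
    using \<epsilon> by (auto simp: interval_ne_empty_cart)
  hence "\<epsilon> ^ CARD('d) = measure lborel (cbox a (a + vec \<epsilon>))"
    using \<epsilon> by (simp add: content_cbox_cart)
  also have "\<dots> \<le> measure lborel (cube \<alpha> \<beta> \<inter> {x. infnorm (x - \<theta>) \<le> \<epsilon>})"
  proof (rule measure_mono_fmeasurable)
    show "cbox a (a + vec \<epsilon>) \<subseteq> cube \<alpha> \<beta> \<inter> {x. infnorm (x - \<theta>) \<le> \<epsilon>}"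
    proof safe
      fix x assume x: "x \<in> cbox a (a + vec \<epsilon>)"
      have *: "max \<alpha> (\<theta> $ i - \<epsilon>) \<le> x $ i" "x $ i \<le> max \<alpha> (\<theta> $ i - \<epsilon>) + \<epsilon>" "\<alpha> \<le> \<theta> $ i" "\<theta> $ i \<le> \<beta>" for i
        using x \<theta> by (auto simp: mem_box_cart a_def)
      show "x \<in> cube \<alpha> \<beta>"
        unfolding mem_box_cart using * \<epsilon> by (smt (verit) vec_component)
      show "infnorm (x - \<theta>) \<le> \<epsilon>"
        unfolding infnorm_cart
      proof (rule cSup_least)
        fix y assume "y \<in> {\<bar>(x - \<theta>) $ i\<bar> |i. i \<in> UNIV}"
        then obtain i where "y = \<bar>(x - \<theta>) $ i\<bar>" by auto
        thus "y \<le> \<epsilon>" using *[of i] \<epsilon> by (simp add: abs_if max_def split: if_splits)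
      qed auto
    qed
    show "cube \<alpha> \<beta> \<inter> {x. infnorm (x - \<theta>) \<le> \<epsilon>} \<in> fmeasurable lborel"
      by (rule fmeasurable_Int_fmeasurable) (use closed in auto)
  qed auto
  finally show ?thesis .
qed

lemma infnorm_diff_cube_le:
  fixes x \<theta> :: "real ^ 'd"
  assumes "x \<in> cube \<alpha> \<beta>" "\<theta> \<in> cube \<alpha> \<beta>"
  shows "infnorm (x - \<theta>) \<le> \<beta> - \<alpha>"
  unfolding infnorm_cart
proof (rule cSup_least)
  fix y assume "y \<in> {\<bar>(x - \<theta>) $ i\<bar> |i. i \<in> UNIV}"
  then obtain i where "y = \<bar>(x - \<theta>) $ i\<bar>" by auto
  moreover have "\<alpha> \<le> x $ i" "x $ i \<le> \<beta>" "\<alpha> \<le> \<theta> $ i" "\<theta> $ i \<le> \<beta>"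
    using assms by (auto simp: mem_box_cart)
  ultimately show "y \<le> \<beta> - \<alpha>" by (simp add: abs_if)
qed auto

section \<open>Tail of the smallest distance to the sample\<close>

text \<open>The minimum exceeds a radius exactly when every sample point misses the closed ball of
  that radius. Measured in side lengths of the cube, radius \<open>t\<close> is hit with probability
  at least \<open>t ^ CARD('d)\<close>. Independence multiplies the probabilities of missing, and
  \<open>1 - x \<le> exp (- x)\<close> bounds each factor.\<close>

lemma (in prob_space) tail_Min_infnorm_le:
  fixes \<Theta> :: "nat \<Rightarrow> 'a \<Rightarrow> real ^ 'd"
  assumes K: "K \<ge> 1" and \<alpha>\<beta>: "\<alpha> < \<beta>"
    and iid: "iid_vars M (cube_borel \<alpha> \<beta>) \<Theta> {1..K}"
    and unif: "distr M lborel (\<Theta> 1) = uniform_measure lborel (cube \<alpha> \<beta>)"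
    and \<theta>: "\<theta> \<in> cube \<alpha> \<beta>" and t: "0 \<le> t"
  shows "prob {\<omega>\<in>space M. t * (\<beta> - \<alpha>) < (MIN k\<in>{1..K}. infnorm (\<Theta> k \<omega> - \<theta>))}
    \<le> exp (- (real K * t ^ CARD('d)))"
proof -
  have ind: "indep_vars (\<lambda>_. cube_borel \<alpha> \<beta>) \<Theta> {1..K}"
    and distr: "\<And>i j. i \<in> {1..K} \<Longrightarrow> j \<in> {1..K} \<Longrightarrow>
      distr M (cube_borel \<alpha> \<beta>) (\<Theta> i) = distr M (cube_borel \<alpha> \<beta>) (\<Theta> j)"
    using iid unfolding iid_vars_def by blast+
  have meas: "\<Theta> k \<in> M \<rightarrow>\<^sub>M cube_borel \<alpha> \<beta>" if "k \<in> {1..K}" for k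
    using ind that by (auto simp: indep_vars_def)
  have in_cube: "\<Theta> k \<omega> \<in> cube \<alpha> \<beta>" if "k \<in> {1..K}" "\<omega> \<in> space M" for k \<omega>
    using measurable_space[OF meas[OF that(1)] that(2)] by (simp add: space_restrict_space)
  let ?E = "{\<omega>\<in>space M. t * (\<beta> - \<alpha>) < (MIN k\<in>{1..K}. infnorm (\<Theta> k \<omega> - \<theta>))}"
  show ?thesis
  proof (cases "t \<le> 1")
    case False
    \<comment> \<open>The volume bound covers radii up to the side length only; no two points of the
      cube are farther apart than that.\<close>
    have "?E = {}"
    proof -
      have False if \<omega>: "\<omega> \<in> ?E" for \<omega>
      proof -
        have "t * (\<beta> - \<alpha>) < infnorm (\<Theta> 1 \<omega> - \<theta>)"
          using \<omega> K by (subst (asm) Min_gr_iff) auto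
        also have "\<dots> \<le> \<beta> - \<alpha>"
          by (rule infnorm_diff_cube_le) (use in_cube[of 1 \<omega>] \<omega> K \<theta> in auto)
        finally show False using False \<alpha>\<beta> by simp
      qed
      thus ?thesis by blast
    qed
    thus ?thesis by (metis measure_empty exp_ge_zero)
  next
    case True
    define \<epsilon> where "\<epsilon> = t * (\<beta> - \<alpha>)"
    have \<epsilon>: "0 \<le> \<epsilon>" "\<epsilon> \<le> \<beta> - \<alpha>"
      using t True \<alpha>\<beta> by (auto simp: \<epsilon>_def mult_left_le_one_le)
    define G where "G = cube \<alpha> \<beta> \<inter> {x. infnorm (x - \<theta>) \<le> \<epsilon>}"
    define B where "B = cube \<alpha> \<beta> - G"
    have G_borel: "G \<in> sets borel"
      unfolding G_def by (intro sets.Int borel_closed closed_Collect_le continuous_intros) auto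
    have G: "G \<in> sets (cube_borel \<alpha> \<beta>)" and B: "B \<in> sets (cube_borel \<alpha> \<beta>)"
      using G_borel by (auto simp: sets_restrict_space_iff B_def) (auto simp: G_def)
    have vol: "measure lborel (cube \<alpha> \<beta> :: (real ^ 'd) set) = (\<beta> - \<alpha>) ^ CARD('d)"
      using \<alpha>\<beta> by (subst content_cbox_cart) (auto simp: interval_ne_empty_cart)
    have p1: "t ^ CARD('d) \<le> prob (\<Theta> k -` G \<inter> space M)" if k: "k \<in> {1..K}" for k
    proof -
      \<comment> \<open>Uniformity is given for \<open>\<Theta> 1\<close>, as a law on the whole
        space. The probability therefore passes to \<open>\<Theta> 1\<close> by equality of laws on
        the cube, and then through the preimage of \<open>G\<close> to the law on
        \<open>lborel\<close>.\<close>
      have "prob (\<Theta> k -` G \<inter> space M) = measure (distr M (cube_borel \<alpha> \<beta>) (\<Theta> k)) G"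
        by (rule measure_distr[symmetric]) (use meas[OF k] G in auto)
      also have "\<dots> = measure (distr M (cube_borel \<alpha> \<beta>) (\<Theta> 1)) G"
        using distr[of k 1] k K by simp
      also have "\<dots> = prob (\<Theta> 1 -` G \<inter> space M)"
        by (rule measure_distr) (use meas[of 1] K G in auto)
      also have "\<dots> = measure (distr M lborel (\<Theta> 1)) G"
        using meas[of 1] K G_borel
        by (intro measure_distr[symmetric]) (auto simp: measurable_restrict_space2_iff)
      also have "\<dots> = measure lborel G / measure lborel (cube \<alpha> \<beta> :: (real ^ 'd) set)"
      proof -
        \<comment> \<open>The quotient formula for a uniform measure asks for a volume that is
          finite and nonzero.\<close>
        have "emeasure lborel (cube \<alpha> \<beta> :: (real ^ 'd) set) \<noteq> \<infinity>"
          using emeasure_lborel_cbox_finite by (metis less_irrefl infinity_ennreal_def)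
        moreover from this have "emeasure lborel (cube \<alpha> \<beta> :: (real ^ 'd) set) \<noteq> 0"
          using vol \<alpha>\<beta> by (auto simp: measure_def)
        moreover have "cube \<alpha> \<beta> \<inter> G = G" by (auto simp: G_def)
        ultimately show ?thesis
          using G_borel unfolding unif by (simp add: measure_uniform_measure)
      qed
      also have "\<dots> \<ge> \<epsilon> ^ CARD('d) / (\<beta> - \<alpha>) ^ CARD('d)"
        unfolding vol G_def using \<alpha>\<beta>
        by (intro divide_right_mono content_infnorm_ball_Int_cube_ge \<theta> \<epsilon>) auto
      also have "\<epsilon> ^ CARD('d) / (\<beta> - \<alpha>) ^ CARD('d) = t ^ CARD('d)"
        using \<alpha>\<beta> by (simp add: \<epsilon>_def power_mult_distrib)
      finally show ?thesis .
    qed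
    have p2: "prob (\<Theta> k -` B \<inter> space M) \<le> 1 - t ^ CARD('d)" if k: "k \<in> {1..K}" for k
    proof -
      have "\<Theta> k -` B \<inter> space M = space M - (\<Theta> k -` G \<inter> space M)"
        using in_cube[OF k] by (auto simp: B_def)
      moreover have "\<Theta> k -` G \<inter> space M \<in> events"
        using measurable_sets[OF meas[OF k] G] .
      ultimately show ?thesis using p1[OF k] by (simp add: prob_compl)
    qed
    have "?E = (\<Inter>k\<in>{1..K}. \<Theta> k -` B \<inter> space M)"
      using K in_cube by (auto simp: B_def G_def \<epsilon>_def Min_gr_iff not_le)
    hence "prob ?E = (\<Prod>k\<in>{1..K}. prob (\<Theta> k -` B \<inter> space M))"
      using indep_varsD_finite[OF ind, of "\<lambda>_. B"] K B by simp
    also have "\<dots> \<le> (\<Prod>k\<in>{1..K}. exp (- (t ^ CARD('d))))"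
    proof (rule prod_mono, safe)
      fix k assume "k \<in> {1..K}"
      from p2[OF this] show "prob (\<Theta> k -` B \<inter> space M) \<le> exp (- (t ^ CARD('d)))"
        using exp_ge_add_one_self[of "- (t ^ CARD('d))"] by simp
    qed simp
    also have "\<dots> = exp (- (real K * t ^ CARD('d)))"
      by (simp add: exp_of_nat_mult[symmetric])
    finally show ?thesis .
  qed
qed

section \<open>Assembling the error bound\<close>

theorem proposition5p6:
  fixes K :: nat and L \<alpha> \<beta> :: real
    and M :: "'w measure"
    and R :: "real ^ 'd \<Rightarrow> 'w \<Rightarrow> real"
    and \<Theta> :: "nat \<Rightarrow> 'w \<Rightarrow> real ^ 'd"
  assumes "K \<ge> 1" and "\<alpha> < \<beta>"
    and "prob_space M"
    and "random_field_on_cube M \<alpha> \<beta> R"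
    and "\<And>\<theta> \<phi> \<omega>. \<theta> \<in> cube \<alpha> \<beta> \<Longrightarrow> \<phi> \<in> cube \<alpha> \<beta> \<Longrightarrow> \<omega> \<in> space M \<Longrightarrow>
           \<bar>R \<theta> \<omega> - R \<phi> \<omega>\<bar> \<le> L * infnorm (\<theta> - \<phi>)"
    and "iid_vars M (cube_borel \<alpha> \<beta>) \<Theta> {1..K}"
    and "distr M lborel (\<Theta> 1) = uniform_measure lborel (cube \<alpha> \<beta>)"
  shows "(\<lambda>(\<theta>, \<omega>). R \<theta> \<omega>) \<in> borel_measurable (cube_borel \<alpha> \<beta> \<Otimes>\<^sub>M M) \<and>
         (\<forall>\<theta>\<in>cube \<alpha> \<beta>. \<forall>p>0.
           integrable M (\<lambda>\<omega>. MIN k\<in>{1..K}. \<bar>R (\<Theta> k \<omega>) \<omega> - R \<theta> \<omega>\<bar> powr p) \<and>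
           (\<integral>\<omega>. (MIN k\<in>{1..K}. \<bar>R (\<Theta> k \<omega>) \<omega> - R \<theta> \<omega>\<bar> powr p) \<partial>M) powr (1 / p)
             \<le> L * (\<beta> - \<alpha>) * max 1 ((p / real CARD('d)) powr (1 / real CARD('d)))
                 / real K powr (1 / real CARD('d)) \<and>
           L * (\<beta> - \<alpha>) * max 1 ((p / real CARD('d)) powr (1 / real CARD('d)))
                 / real K powr (1 / real CARD('d))
             \<le> L * (\<beta> - \<alpha>) * max 1 p / real K powr (1 / real CARD('d)))"
proof -
  interpret prob_space M by fact
  note lip = assms(5)
  have K: "0 < real K" using assms(1) by simp
  \<comment> \<open>The sign of \<open>L\<close> is forced: two opposite corners have positive
    distance, and the Lipschitz bound between them, at any outcome, has a nonnegative left
    side.\<close>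
  have L: "0 \<le> L"
  proof -
    have cube: "vec \<alpha> \<in> (cube \<alpha> \<beta> :: (real ^ 'd) set)" "vec \<beta> \<in> (cube \<alpha> \<beta> :: (real ^ 'd) set)"
      using assms(2) by (auto simp: mem_box_cart)
    obtain \<omega> where "\<omega> \<in> space M" using not_empty by blast
    from lip[OF cube this] have "0 \<le> L * infnorm (vec \<alpha> - vec \<beta> :: real ^ 'd)"
      by linarith
    moreover have "0 < infnorm (vec \<alpha> - vec \<beta> :: real ^ 'd)"
      using assms(2) by (auto simp: infnorm_pos_lt vec_eq_iff)
    ultimately show ?thesis by (simp add: zero_le_mult_iff)
  qed
  have joint: "(\<lambda>(\<theta>, \<omega>). R \<theta> \<omega>) \<in> borel_measurable (cube_borel \<alpha> \<beta> \<Otimes>\<^sub>M M)"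
  proof (rule borel_measurable_lipschitz_random_field[OF _ _ L])
    fix \<theta> \<phi> :: "real ^ 'd" and \<omega> assume "\<theta> \<in> cube \<alpha> \<beta>" "\<phi> \<in> cube \<alpha> \<beta>" "\<omega> \<in> space M"
    from lip[OF this] show "\<bar>R \<theta> \<omega> - R \<phi> \<omega>\<bar> \<le> L * dist \<theta> \<phi>"
      using mult_left_mono[OF infnorm_le_norm[of "\<theta> - \<phi>"] L] by (simp add: dist_norm)
  qed (use assms(4) in \<open>auto simp: random_field_on_cube_def\<close>)
  have \<Theta>: "\<Theta> k \<in> M \<rightarrow>\<^sub>M cube_borel \<alpha> \<beta>" if "k \<in> {1..K}" for k
    using assms(6) that unfolding iid_vars_def indep_vars_def by blast
  have in_cube: "\<Theta> k \<omega> \<in> cube \<alpha> \<beta>" if "k \<in> {1..K}" "\<omega> \<in> space M" for k \<omega>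
    using measurable_space[OF \<Theta>[OF that(1)] that(2)] by (simp add: space_restrict_space)
  have [measurable]: "(infnorm :: real ^ 'd \<Rightarrow> real) \<in> borel_measurable borel"
    by (intro borel_measurable_continuous_onI continuous_intros)
  have main: "integrable M F \<and> (\<integral>\<omega>. F \<omega> \<partial>M) powr (1 / p) \<le> B"
    if \<theta>: "\<theta> \<in> cube \<alpha> \<beta>" and p: "0 < p"
      and F: "F = (\<lambda>\<omega>. MIN k\<in>{1..K}. \<bar>R (\<Theta> k \<omega>) \<omega> - R \<theta> \<omega>\<bar> powr p)"
      and B: "B = L * (\<beta> - \<alpha>) * max 1 ((p / real CARD('d)) powr (1 / real CARD('d)))
        / real K powr (1 / real CARD('d))"
    for \<theta> p F B
  proof -
    define d where "d = real CARD('d)"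
    have d: "1 \<le> d" unfolding d_def by (simp add: Suc_leI)
    define a where "a = p / d"
    have a: "0 < a" using p d by (simp add: a_def)
    define U where "U \<omega> = (MIN k\<in>{1..K}. infnorm (\<Theta> k \<omega> - \<theta>))" for \<omega>
    define V where "V \<omega> = real K * (U \<omega> / (\<beta> - \<alpha>)) powr d" for \<omega>
    \<comment> \<open>With this factor \<open>c * V powr a\<close> equals
      \<open>(L * U) powr p\<close>: the power of \<open>K\<close> contained in
      \<open>V powr a\<close> cancels the denominator.\<close>
    define c where "c = (L * (\<beta> - \<alpha>)) powr p / real K powr a"
    have c: "0 \<le> c" by (simp add: c_def)
    have [measurable]: "U \<in> borel_measurable M"
      unfolding U_def
    proof (rule borel_measurable_Min)
      fix k assume "k \<in> {1..K}"
      hence [measurable]: "\<Theta> k \<in> borel_measurable M"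
        using \<Theta> by (auto simp: measurable_restrict_space2_iff)
      show "(\<lambda>\<omega>. infnorm (\<Theta> k \<omega> - \<theta>)) \<in> borel_measurable M" by measurable
    qed simp
    have [measurable]: "V \<in> borel_measurable M" unfolding V_def by measurable
    have [measurable]: "R \<theta> \<in> borel_measurable M"
      using assms(4) \<theta> by (auto simp: random_field_on_cube_def)
    have [measurable]: "F \<in> borel_measurable M"
      unfolding F
    proof (rule borel_measurable_Min)
      fix k assume k: "k \<in> {1..K}"
      \<comment> \<open>Inserting a random point into the field calls for joint measurability: the
        map is the field composed with the pairing of \<open>\<Theta> k\<close> and the
        identity.\<close>
      have [measurable]: "(\<lambda>\<omega>. R (\<Theta> k \<omega>) \<omega>) \<in> borel_measurable M"
        using measurable_compose[OF measurable_Pair[OF \<Theta>[OF k] measurable_ident] joint] by simp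
      show "(\<lambda>\<omega>. \<bar>R (\<Theta> k \<omega>) \<omega> - R \<theta> \<omega>\<bar> powr p) \<in> borel_measurable M" by measurable
    qed simp
    have nonempty: "{1..K} \<noteq> {}" using assms(1) by simp
    have U: "0 \<le> U \<omega>" "U \<omega> \<le> \<beta> - \<alpha>" if "\<omega> \<in> space M" for \<omega>
    proof -
      show "0 \<le> U \<omega>" unfolding U_def
        using nonempty by (subst Min_ge_iff) (auto simp: infnorm_pos_le)
      have "U \<omega> \<le> infnorm (\<Theta> 1 \<omega> - \<theta>)"
        unfolding U_def using assms(1) by (intro Min_le) auto
      also have "\<dots> \<le> \<beta> - \<alpha>"
        using infnorm_diff_cube_le[OF in_cube[of 1 \<omega>] \<theta>] assms(1) that by simp
      finally show "U \<omega> \<le> \<beta> - \<alpha>" .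
    qed
    have F_nonneg: "0 \<le> F \<omega>" for \<omega>
      unfolding F using nonempty by (subst Min_ge_iff) auto
    have F_le_U: "F \<omega> \<le> (L * U \<omega>) powr p" if \<omega>: "\<omega> \<in> space M" for \<omega>
    proof -
      \<comment> \<open>The nearest sample point need not minimise the error, but its error bounds
        the minimum from above.\<close>
      have "U \<omega> \<in> (\<lambda>k. infnorm (\<Theta> k \<omega> - \<theta>)) ` {1..K}"
        unfolding U_def using nonempty by (intro Min_in) auto
      then obtain k where k: "k \<in> {1..K}" "U \<omega> = infnorm (\<Theta> k \<omega> - \<theta>)" by auto
      have "F \<omega> \<le> \<bar>R (\<Theta> k \<omega>) \<omega> - R \<theta> \<omega>\<bar> powr p"
        unfolding F using k by (intro Min_le) auto
      also have "\<dots> \<le> (L * U \<omega>) powr p"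
        unfolding k(2) using lip[OF in_cube[OF k(1) \<omega>] \<theta> \<omega>] p by (intro powr_mono2) auto
      finally show ?thesis .
    qed
    have F_le: "F \<omega> \<le> c * V \<omega> powr a" if \<omega>: "\<omega> \<in> space M" for \<omega>
    proof -
      define u where "u = U \<omega> / (\<beta> - \<alpha>)"
      have u: "0 \<le> u" "L * U \<omega> = (L * (\<beta> - \<alpha>)) * u"
        using U[OF \<omega>] assms(2) by (auto simp: u_def)
      have "c * V \<omega> powr a = (L * (\<beta> - \<alpha>)) powr p * u powr p"
        using K d u by (simp add: c_def V_def u_def[symmetric] powr_mult powr_powr a_def)
      also have "\<dots> = (L * U \<omega>) powr p"
        unfolding u(2) using L assms(2) u by (simp add: powr_mult)
      finally show ?thesis using F_le_U[OF \<omega>] by simp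
    qed
    \<comment> \<open>The integral of a non-integrable function is 0 by convention, so integrability
      is proved alongside the bound. It holds because \<open>U\<close> is at most the side
      length.\<close>
    have int: "integrable M F"
    proof (rule integrable_const_bound)
      show "AE \<omega> in M. norm (F \<omega>) \<le> (L * (\<beta> - \<alpha>)) powr p"
      proof (rule AE_I2)
        fix \<omega> assume \<omega>: "\<omega> \<in> space M"
        have "F \<omega> \<le> (L * U \<omega>) powr p" by (rule F_le_U[OF \<omega>])
        also have "\<dots> \<le> (L * (\<beta> - \<alpha>)) powr p"
          using U[OF \<omega>] L p by (intro powr_mono2 mult_left_mono) auto
        finally show "norm (F \<omega>) \<le> (L * (\<beta> - \<alpha>)) powr p" using F_nonneg by simp
      qed
    qed measurable
    have tail: "emeasure M {\<omega>\<in>space M. v < V \<omega>} \<le> ennreal (exp (- v))" if v: "0 \<le> v" for v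
    proof -
      \<comment> \<open>Chosen to solve \<open>K * t powr d = v\<close>, so that the tail bound at
        radius \<open>t\<close> becomes \<open>exp (- v)\<close>.\<close>
      define t where "t = (v / real K) powr (1 / d)"
      have t: "0 \<le> t" "t powr d = v / real K"
        using v K d by (auto simp: t_def powr_powr)
      have "v < V \<omega> \<Longrightarrow> t * (\<beta> - \<alpha>) < U \<omega>" if \<omega>: "\<omega> \<in> space M" for \<omega>
      proof (rule ccontr)
        assume "v < V \<omega>" "\<not> t * (\<beta> - \<alpha>) < U \<omega>"
        hence "U \<omega> / (\<beta> - \<alpha>) \<le> t" using assms(2) by (simp add: field_simps)
        hence "(U \<omega> / (\<beta> - \<alpha>)) powr d \<le> v / real K"
          unfolding t(2)[symmetric] using d U[OF \<omega>] assms(2) by (intro powr_mono2) auto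
        with \<open>v < V \<omega>\<close> K show False by (simp add: V_def field_simps)
      qed
      hence "{\<omega>\<in>space M. v < V \<omega>} \<subseteq> {\<omega>\<in>space M. t * (\<beta> - \<alpha>) < U \<omega>}" by blast
      hence "prob {\<omega>\<in>space M. v < V \<omega>} \<le> prob {\<omega>\<in>space M. t * (\<beta> - \<alpha>) < U \<omega>}"
        by (rule finite_measure_mono) measurable
      also have "\<dots> \<le> exp (- (real K * t ^ CARD('d)))"
        unfolding U_def by (rule tail_Min_infnorm_le[OF assms(1,2,6,7) \<theta> t(1)])
      \<comment> \<open>Real and natural powers agree for positive \<open>t\<close>; at 0 both
        vanish.\<close>
      also have "t ^ CARD('d) = v / real K"
        using t by (cases "t = 0") (auto simp: d_def powr_realpow)
      finally show ?thesis using K by (simp add: emeasure_eq_measure)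
    qed
    have "ennreal (\<integral>\<omega>. F \<omega> \<partial>M) = (\<integral>\<^sup>+\<omega>. F \<omega> \<partial>M)"
      using int F_nonneg by (intro nn_integral_eq_integral[symmetric]) auto
    also have "\<dots> \<le> (\<integral>\<^sup>+\<omega>. ennreal c * ennreal (V \<omega> powr a) \<partial>M)"
      using F_le c by (intro nn_integral_mono) (simp add: ennreal_mult[symmetric] ennreal_leI)
    also have "\<dots> = ennreal c * (\<integral>\<^sup>+\<omega>. ennreal (V \<omega> powr a) \<partial>M)"
      by (rule nn_integral_cmult) measurable
    also have "\<dots> \<le> ennreal c * ennreal (Gamma (a + 1))"
      by (intro mult_left_mono nn_integral_powr_le_Gamma tail a)
         (use K in \<open>auto simp: V_def intro: prob_space_axioms\<close>)
    also have "\<dots> \<le> ennreal c * ennreal (max 1 (a powr a))"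
      by (intro mult_left_mono ennreal_leI Gamma_add_one_le a) auto
    also have "\<dots> = ennreal (c * max 1 (a powr a))"
      using c by (simp add: ennreal_mult)
    finally have "(\<integral>\<omega>. F \<omega> \<partial>M) \<le> c * max 1 (a powr a)"
      using c by (subst (asm) ennreal_le_iff) (auto intro!: mult_nonneg_nonneg simp: le_max_iff_disj)
    \<comment> \<open>The maximum is written as a \<open>p\<close>-th power to prepare the root.
      This works because \<open>a powr a\<close> and \<open>a powr (1 / d)\<close> lie on the same
      side of 1.\<close>
    also have "max 1 (a powr a) = max 1 (a powr (1 / d)) powr p"
    proof (cases "a \<le> 1")
      case True
      hence "a powr a \<le> 1" "a powr (1 / d) \<le> 1"
        using a d by (auto intro!: powr_le1)
      thus ?thesis by (simp add: max_def)
    next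
      case False
      hence "1 \<le> a powr a" "1 \<le> a powr (1 / d)"
        using d by (auto intro!: ge_one_powr_ge_zero)
      thus ?thesis by (simp add: max_def powr_powr a_def)
    qed
    also have "c * \<dots> = B powr p"
      using L K assms(2)
      by (simp add: B c_def a_def d_def[symmetric] powr_mult powr_divide powr_powr)
    finally have "(\<integral>\<omega>. F \<omega> \<partial>M) powr (1 / p) \<le> (B powr p) powr (1 / p)"
      using F_nonneg p by (intro powr_mono2 integral_nonneg) auto
    also have "\<dots> = B"
      using L assms(2) p by (simp add: powr_powr B)
    finally show ?thesis using int by blast
  qed
  \<comment> \<open>If \<open>p / d\<close> is at most 1, so is its root; otherwise the root is at
    most \<open>p / d\<close>, hence at most \<open>p\<close>.\<close>
  have "max 1 ((p / real CARD('d)) powr (1 / real CARD('d))) \<le> max 1 p" if p: "0 < p" for p :: real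
  proof (cases "p / real CARD('d) \<le> 1")
    case True
    hence "(p / real CARD('d)) powr (1 / real CARD('d)) \<le> 1"
      using p by (intro powr_le1) auto
    thus ?thesis by simp
  next
    case False
    hence "(p / real CARD('d)) powr (1 / real CARD('d)) \<le> (p / real CARD('d)) powr 1"
      by (intro powr_mono) (auto simp: Suc_leI)
    also have "\<dots> \<le> p"
      using p by (simp add: divide_le_eq Suc_leI)
    finally show ?thesis by simp
  qed
  hence "L * (\<beta> - \<alpha>) * max 1 ((p / real CARD('d)) powr (1 / real CARD('d)))
        / real K powr (1 / real CARD('d))
      \<le> L * (\<beta> - \<alpha>) * max 1 p / real K powr (1 / real CARD('d))" if "0 < p" for p :: real
    using that L assms(2) by (intro divide_right_mono mult_left_mono) auto
  with joint main show ?thesis by blast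
qed

end
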